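(* Let $f$ be convex-concave in $(x,\xi)$, i.e. $x\mapsto f(x,\xi)$ is convex for each $\xi\in\mathbb{R}^m$ and $\xi\mapsto f(x,\xi)$ is concave for each $x\in\mathbb{R}^d$. Then, for any $(\nu,\eta)\in\mathbb{R}^n\times\mathbb{R}^{nd}$, $$\min_{x_{\mathrm v},\,\lambda_{\mathrm v}\ge\mathbf 0_n}\;\max_{\{\xi^k\}}\tilde L_{\mathrm{aug}}(x_{\mathrm v},\lambda_{\mathrm v},\nu,\eta,\{\xi^k\})=\max_{\{\xi^k\}}\;\min_{x_{\mathrm v},\,\lambda_{\mathrm v}\ge\mathbf 0_n}\tilde L_{\mathrm{aug}}(x_{\mathrm v},\lambda_{\mathrm v},\nu,\eta,\{\xi^k\}).$$
   Context: $n,N,d,m$ are positive integers and $\epsilon\ge 0$. $\mathcal G$ is a connected undirected weighted graph on the vertex set $\{1,\dots,n\}$ (the agents) with symmetric adjacency matrix $\mathsf A=(a_{ij})$, $a_{ij}>0$ if $(i,j)$ is an edge and $a_{ij}=0$ otherwise; $\mathsf L=\mathsf D-\mathsf A$ is its Laplacian, where $\mathsf D$ is the diagonal matrix with entries $\sum_j a_{ij}$. The samples $\hat\xi^{\,1},\dots,\hat\xi^{\,N}\in\mathbb{R}^m$ are distributed among the agents: each sample is held by exactly one agent and each agent holds at least one; $v_k\in\{1,\dots,n\}$ is the agent holding $\hat\xi^{\,k}$. The function $f:\mathbb{R}^d\times\mathbb{R}^m\to\mathbb{R}$ is continuously differentiable, and the set of $\xi\in\mathbb{R}^m$ for which neither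 $\mathbf 1_d$ nor $-\mathbf 1_d$ is a direction of recession of $x\mapsto f(x,\xi)$ is dense in $\mathbb{R}^m$ (a vector $w$ is a direction of recession of a finite convex function $\phi$ if $\phi(x+\alpha w)\le\phi(x)$ for all $x$ and $\alpha\ge0$). Notation: $h(\lambda_{\mathrm v}):=\epsilon^2(\mathbf 1_n^\top\lambda_{\mathrm v})/n$; $g_k(x,\lambda,\xi):=f(x,\xi)-\lambda\|\xi-\hat\xi^{\,k}\|^2$; $x_{\mathrm v}=(x^1;\dots;x^n)\in\mathbb{R}^{nd}$ with $x^i\in\mathbb{R}^d$; $\lambda_{\mathrm v}=(\lambda^1;\dots;\lambda^n)\in\mathbb{R}^n$; $\{\xi^k\}=(\xi^1,\dots,\xi^N)$ with $\xi^k\in\mathbb{R}^m$; $$\tilde L_{\mathrm{aug}}(x_{\mathrm v},\lambda_{\mathrm v},\nu,\eta,\{\xi^k\}):=h(\lambda_{\mathrm v})+\frac1N\sum_{k=1}^Ng_k(x^{v_k},\lambda^{v_k},\xi^k)+\nu^\top\mathsf L\lambda_{\mathrm v}+\eta^\top(\mathsf L\otimes\mathsf I_d)x_{\mathrm v}+\tfrac12x_{\mathrm v}^\top(\mathsf L\otimes\mathsf I_d)x_{\mathrm v}+\tfrac12\lambda_{\mathrm v}^\top\mathsf L\lambda_{\mathrm v}.$$ $\mathbf 1_n,\mathbf 0_n$ are the all-ones and zero vectors, $\mathsf I_d$ the identity, $\otimes$ the Kronecker product; vector inequalities are componentwise. The symbols $\min$ and $\max$ are read as infimum and supremum in the extended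 reals. Standing assumption: for problem (P), $\inf_{\lambda\ge0,\,x\in\mathbb{R}^d}\{\lambda\epsilon^2+\frac1N\sum_{k=1}^N\max_{\xi\in\mathbb{R}^m}g_k(x,\lambda,\xi)\}$, the set of $(\lambda,x)\in\mathbb{R}_{\ge0}\times\mathbb{R}^d$ at which the objective is finite has nonempty interior, and there exists a finite optimizer $(x^*,\lambda^* )$. *)

theory Defs
  imports "HOL-Analysis.Analysis"
begin

text \<open>
  The positive integers \<open>n\<close>, \<open>N\<close>, \<open>d\<close>, \<open>m\<close> are the cardinalities of the finite index types
  \<open>'n\<close> (agents), \<open>'k\<close> (samples), \<open>'d\<close> and \<open>'m\<close>. A vector of \<open>\<real>\<^sup>n\<^sup>d\<close> is indexed by
  pairs (agent, coordinate), and \<open>1\<close> in a vector type is the all-ones vector.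
\<close>

definition weighted_graph :: "('n \<times> 'n) set \<Rightarrow> real^'n^'n \<Rightarrow> bool" where
  "weighted_graph E A \<longleftrightarrow>
     sym E \<and> transpose A = A \<and>
     (\<forall>i j. ((i, j) \<in> E \<longrightarrow> A $ i $ j > 0) \<and> ((i, j) \<notin> E \<longrightarrow> A $ i $ j = 0))"

definition graph_connected :: "('n \<times> 'n) set \<Rightarrow> bool" where
  "graph_connected E \<longleftrightarrow> (\<forall>i j. (i, j) \<in> E\<^sup>*)"

definition degree_matrix :: "real^'n^'n \<Rightarrow> real^'n^'n" where
  "degree_matrix A = (\<chi> i j. if i = j then (\<Sum>l\<in>UNIV. A $ i $ l) else 0)"

definition laplacian :: "real^'n^'n \<Rightarrow> real^'n^'n" where
  "laplacian A = degree_matrix A - A"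

definition kronecker :: "real^'b::finite^'a::finite \<Rightarrow> real^'q::finite^'p::finite \<Rightarrow> real^('b \<times> 'q)^('a \<times> 'p)" where
  "kronecker A B = (\<chi> r c. A $ fst r $ fst c * B $ snd r $ snd c)"

definition block :: "real^('n::finite \<times> 'd::finite) \<Rightarrow> 'n \<Rightarrow> real^'d" where
  "block xv i = (\<chi> j. xv $ (i, j))"

definition continuously_differentiable ::
  "('a::real_normed_vector \<Rightarrow> 'b::real_normed_vector) \<Rightarrow> bool" where
  "continuously_differentiable F \<longleftrightarrow>
     (\<exists>F' :: 'a \<Rightarrow> 'a \<Rightarrow>\<^sub>L 'b.
        (\<forall>p. (F has_derivative blinfun_apply (F' p)) (at p)) \<and> continuous_on UNIV F')"

definition recession_direction :: "('a::real_vector \<Rightarrow> real) \<Rightarrow> 'a \<Rightarrow> bool" where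
  "recession_direction \<phi> w \<longleftrightarrow> (\<forall>x. \<forall>\<alpha>\<ge>0. \<phi> (x + \<alpha> *\<^sub>R w) \<le> \<phi> x)"

definition g_fun ::
  "(real^'d \<Rightarrow> real^'m \<Rightarrow> real) \<Rightarrow> ('k \<Rightarrow> real^'m) \<Rightarrow> 'k \<Rightarrow> real^'d \<Rightarrow> real \<Rightarrow> real^'m \<Rightarrow> real"
where
  "g_fun f \<xi>hat k x l \<xi> = f x \<xi> - l * (norm (\<xi> - \<xi>hat k))\<^sup>2"

definition h_fun :: "real \<Rightarrow> real^'n \<Rightarrow> real" where
  "h_fun \<epsilon> lv = \<epsilon>\<^sup>2 * (1 \<bullet> lv) / real CARD('n)"

text \<open>
  In the objective of (P) every inner supremum is above \<open>-\<infinity>\<close>, so the extended-real sum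
  never involves \<open>\<infinity> - \<infinity>\<close>.
\<close>

definition P_objective ::
  "real \<Rightarrow> (real^'d \<Rightarrow> real^'m \<Rightarrow> real) \<Rightarrow> ('k::finite \<Rightarrow> real^'m) \<Rightarrow> real \<Rightarrow> real^'d \<Rightarrow> ereal"
where
  "P_objective \<epsilon> f \<xi>hat l x =
     ereal (l * \<epsilon>\<^sup>2) +
     ereal (1 / real CARD('k)) * (\<Sum>k\<in>UNIV. SUP \<xi>. ereal (g_fun f \<xi>hat k x l \<xi>))"

definition L_aug ::
  "real \<Rightarrow> (real^'d \<Rightarrow> real^'m \<Rightarrow> real) \<Rightarrow> ('k::finite \<Rightarrow> real^'m) \<Rightarrow> ('k \<Rightarrow> 'n) \<Rightarrow> real^'n^'n \<Rightarrow>
   real^('n::finite \<times> 'd::finite) \<Rightarrow> real^'n \<Rightarrow> real^'n \<Rightarrow> real^('n \<times> 'd) \<Rightarrow> ('k \<Rightarrow> real^'m) \<Rightarrow> real"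
where
  "L_aug \<epsilon> f \<xi>hat v A xv lv \<nu> \<eta> \<xi>s =
     h_fun \<epsilon> lv
     + 1 / real CARD('k) * (\<Sum>k\<in>UNIV. g_fun f \<xi>hat k (block xv (v k)) (lv $ v k) (\<xi>s k))
     + \<nu> \<bullet> (laplacian A *v lv)
     + \<eta> \<bullet> (kronecker (laplacian A) (mat 1 :: real^'d^'d) *v xv)
     + 1/2 * (xv \<bullet> (kronecker (laplacian A) (mat 1 :: real^'d^'d) *v xv))
     + 1/2 * (lv \<bullet> (laplacian A *v lv))"

end

theory Submission
  imports Defs
begin

text \<open>
  At the consensus point \<open>\<lambda> = 1\<close>, \<open>x = 0\<close> the concave function \<open>f 0\<close> grows at most linearly while
  the penalty \<open>\<parallel>\<xi> - \<xi>hat\<parallel>\<^sup>2\<close> is quadratic, so the superlevel sets of the augmented Lagrangian in \<open>\<xi>\<close>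
  are compact there. For a convex-concave function one such coercive point already closes the
  duality gap: separation in the plane handles two points of the minimizing set, an induction
  finitely many, and compactness of the coercive superlevel set all of them. The Laplacian terms
  are convex because the graph Laplacian is positive semidefinite.
\<close>

section \<open>Minimax for convex-concave functions with one coercive point\<close>

text \<open>The pairs strictly below \<open>(K a y, K b y)\<close> for some \<open>y\<close> form a
  convex set, by concavity, and \<open>none\<close> keeps \<open>(\<beta>, \<beta>)\<close> out of
  it. This set is closed under lowering either coordinate, so a separating line has a normal with
  nonnegative entries; normalised, they are the weights of the required point of the
  segment.\<close>

lemma minimax_two_points:
  fixes K :: "'a::real_vector \<Rightarrow> 'b::real_vector \<Rightarrow> real"
  assumes Y: "convex Y" "Y \<noteq> {}"
    and cvx: "\<And>y. y \<in> Y \<Longrightarrow> convex_on (closed_segment a b) (\<lambda>x. K x y)"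
    and cca: "concave_on Y (K a)" and ccb: "concave_on Y (K b)"
    and none: "\<And>y. y \<in> Y \<Longrightarrow> K a y > \<beta> \<Longrightarrow> K b y \<le> \<beta>"
  shows "\<exists>x\<in>closed_segment a b. \<forall>y\<in>Y. K x y \<le> \<beta>"
proof -
  define T where "T = {(s, t) | s t. \<exists>y\<in>Y. s < K a y \<and> t < K b y}"
  have in_T: "(s, t) \<in> T" if "y \<in> Y" "s < K a y" "t < K b y" for s t y
    using that by (auto simp: T_def)
  have conc: "u * p + w * q < H (u *\<^sub>R y + w *\<^sub>R z)"
    if "concave_on Y H" "y \<in> Y" "z \<in> Y" "0 \<le> u" "0 \<le> w" "u + w = 1" "p < H y" "q < H z"
    for H :: "'b \<Rightarrow> real" and y z u w p q
  proof -
    have "u * p + w * q < u * H y + w * H z"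
    \<comment> \<open>Strictness comes from the first summand unless its weight vanishes; then
      \<open>w = 1\<close> and the second summand supplies it.\<close>
    proof (cases "u = 0")
      case False
      then have "u * p < u * H y" "w * q \<le> w * H z"
        using that by (auto intro: mult_left_mono)
      then show ?thesis by simp
    qed (use that in auto)
    also have "\<dots> \<le> H (u *\<^sub>R y + w *\<^sub>R z)"
      using that by (auto simp: concave_on_iff)
    finally show ?thesis .
  qed
  have "convex T"
    unfolding convex_def T_def
    by clarsimp (metis conc[OF cca] conc[OF ccb] convexD[OF Y(1)])
  moreover obtain y0 where "y0 \<in> Y" using Y by blast
  then have "(K a y0 - 1, K b y0 - 1) \<in> T" by (intro in_T) auto
  then have "T \<noteq> {}" by blast
  moreover have "{(\<beta>, \<beta>)} \<inter> T = {}"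
    unfolding T_def using none by force
  ultimately obtain c e where c: "c \<noteq> 0" and eT: "\<forall>z\<in>T. inner c z \<le> e"
    and e: "inner c (\<beta>, \<beta>) \<ge> e"
    using separating_hyperplane_sets[of T "{(\<beta>, \<beta>)}"] by auto
  obtain p q where pq: "c = (p, q)" by (cases c)
  have le: "p * s + q * t \<le> (p + q) * \<beta>" if "(s, t) \<in> T" for s t
    using eT[rule_format, OF that] e by (simp add: pq algebra_simps)
  have nonneg: "r \<ge> 0" if *: "\<And>M. M \<ge> 0 \<Longrightarrow> C - r * M \<le> B" for r C B :: real
  proof (rule ccontr)
    assume "\<not> r \<ge> 0"
    \<comment> \<open>Chosen so that \<open>- r * M\<close> equals
      \<open>\<bar>B - C\<bar> + 1\<close>, which lifts the left side above
      \<open>B\<close>.\<close>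
    define M where "M = (\<bar>B - C\<bar> + 1) / - r"
    have "C - r * M = C + (\<bar>B - C\<bar> + 1)"
      using \<open>\<not> r \<ge> 0\<close> by (simp add: M_def)
    moreover have "M \<ge> 0"
      unfolding M_def using \<open>\<not> r \<ge> 0\<close> by (intro divide_nonneg_nonneg) auto
    ultimately show False using *[of M] by linarith
  qed
  have "p \<ge> 0"
  proof (rule nonneg)
    fix M :: real assume "M \<ge> 0"
    then show "(p * (K a y0 - 1) + q * (K b y0 - 1)) - p * M \<le> (p + q) * \<beta>"
      using le[OF in_T[OF \<open>y0 \<in> Y\<close>, of "K a y0 - 1 - M" "K b y0 - 1"]]
      by (simp add: algebra_simps)
  qed
  have "q \<ge> 0"
  proof (rule nonneg)
    fix M :: real assume "M \<ge> 0"
    then show "(p * (K a y0 - 1) + q * (K b y0 - 1)) - q * M \<le> (p + q) * \<beta>"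
      using le[OF in_T[OF \<open>y0 \<in> Y\<close>, of "K a y0 - 1" "K b y0 - 1 - M"]]
      by (simp add: algebra_simps)
  qed
  have pos: "p + q > 0"
    using c \<open>p \<ge> 0\<close> \<open>q \<ge> 0\<close> by (auto simp: pq zero_prod_def)
  \<comment> \<open>The corner \<open>(K a y, K b y)\<close> is only a limit of points of
    \<open>T\<close>. Lowering both coordinates by \<open>d / (p + q)\<close> enters
    \<open>T\<close> and costs exactly \<open>d\<close>.\<close>
  have K_le: "p * K a y + q * K b y \<le> (p + q) * \<beta>" if "y \<in> Y" for y
  proof (rule field_le_epsilon)
    fix d :: real assume "d > 0"
    then have "p * (K a y - d / (p + q)) + q * (K b y - d / (p + q)) \<le> (p + q) * \<beta>"
      using le[OF in_T[OF that, of "K a y - d / (p + q)" "K b y - d / (p + q)"]] pos by simp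
    moreover have "p * (K a y - d / (p + q)) + q * (K b y - d / (p + q))
        = p * K a y + q * K b y - (p + q) * (d / (p + q))"
      by (simp only: left_diff_distrib right_diff_distrib distrib_right)
    moreover have "(p + q) * (d / (p + q)) = d" using pos by simp
    ultimately show "p * K a y + q * K b y \<le> (p + q) * \<beta> + d" by linarith
  qed
  define w where "w = q / (p + q)"
  have w: "0 \<le> w" "w \<le> 1" "1 - w = p / (p + q)"
    using \<open>p \<ge> 0\<close> \<open>q \<ge> 0\<close> pos by (auto simp: w_def field_simps)
  let ?x = "(1 - w) *\<^sub>R a + w *\<^sub>R b"
  have "K ?x y \<le> \<beta>" if "y \<in> Y" for y
  proof -
    have "K ?x y \<le> (1 - w) * K a y + w * K b y"
      using convex_onD[OF cvx[OF that] w(1,2)] by simp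
    also have "\<dots> = (p * K a y + q * K b y) / (p + q)"
      unfolding w(3) by (simp add: w_def add_divide_distrib)
    also have "\<dots> \<le> \<beta>"
      using K_le[OF that] pos by (simp add: field_simps)
    finally show ?thesis .
  qed
  moreover have "?x \<in> closed_segment a b"
    using w(1,2) by (auto simp: closed_segment_def)
  ultimately show ?thesis by blast
qed

text \<open>Induction on \<open>F\<close>, with \<open>Y\<close> shrunk to the strict superlevel set
  of the new point \<open>a\<close>; hence \<open>Y\<close> has to be arbitrary. The hypothesis
  survives the shrinking: if some \<open>x\<close> in the hull of \<open>F\<close> stayed at or
  below \<beta> on the smaller set, the two-point case would give a point between \<open>a\<close>
  and \<open>x\<close> that is at or below \<beta> on all of \<open>Y\<close>.\<close>

lemma minimax_finite:
  fixes K :: "'a::real_vector \<Rightarrow> 'b::real_vector \<Rightarrow> real"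
  assumes "finite F" "F \<noteq> {}" "convex Y"
    and "\<And>y. y \<in> Y \<Longrightarrow> convex_on (convex hull F) (\<lambda>x. K x y)"
    and "\<And>x. x \<in> convex hull F \<Longrightarrow> concave_on Y (K x)"
    and "\<And>x. x \<in> convex hull F \<Longrightarrow> \<exists>y\<in>Y. K x y > \<beta>"
  shows "\<exists>y\<in>Y. \<forall>x\<in>F. K x y > \<beta>"
  using assms
proof (induction F arbitrary: Y rule: finite_ne_induct)
  case (singleton a)
  then show ?case by auto
next
  case (insert a F)
  define Y' where "Y' = {y \<in> Y. K a y > \<beta>}"
  have a: "a \<in> convex hull (insert a F)" by (simp add: hull_inc)
  have sub: "convex hull F \<subseteq> convex hull (insert a F)"
    by (intro hull_mono) auto
  note cca = insert.prems(3)[OF a]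
  have cY': "convex Y'"
    unfolding convex_def
  proof (intro ballI allI impI)
    fix y z and u w :: real
    assume *: "y \<in> Y'" "z \<in> Y'" "0 \<le> u" "0 \<le> w" "u + w = 1"
    then have "u * K a y + w * K a z \<le> K a (u *\<^sub>R y + w *\<^sub>R z)"
      using cca by (auto simp: concave_on_iff Y'_def)
    moreover have "u * K a y + w * K a z > \<beta>"
      using * convex_bound_lt[of "- K a y" "- \<beta>" "- K a z" u w] by (auto simp: Y'_def)
    ultimately show "u *\<^sub>R y + w *\<^sub>R z \<in> Y'"
      using * insert.prems(1) by (auto simp: Y'_def convex_def)
  qed
  have "\<exists>y\<in>Y'. K x y > \<beta>" if x: "x \<in> convex hull F" for x
  proof (rule ccontr)
    assume no: "\<not> (\<exists>y\<in>Y'. K x y > \<beta>)"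
    have x': "x \<in> convex hull (insert a F)" using x sub by blast
    have seg: "closed_segment a x \<subseteq> convex hull (insert a F)"
      using a x' by (simp add: closed_segment_subset)
    have "\<exists>z\<in>closed_segment a x. \<forall>y\<in>Y. K z y \<le> \<beta>"
    proof (rule minimax_two_points)
      show "Y \<noteq> {}" using insert.prems(4)[OF a] by blast
      show "convex_on (closed_segment a x) (\<lambda>x. K x y)" if "y \<in> Y" for y
        using insert.prems(2)[OF that] seg by (rule convex_on_subset) auto
      show "K x y \<le> \<beta>" if "y \<in> Y" "K a y > \<beta>" for y
        using no that by (force simp: Y'_def)
    qed (use insert.prems cca x' in auto)
    with seg insert.prems(4) show False by force
  qed
  then have "\<exists>y\<in>Y'. \<forall>x\<in>F. K x y > \<beta>"
  proof (intro insert.IH cY')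
    show "convex_on (convex hull F) (\<lambda>x. K x y)" if "y \<in> Y'" for y
      using insert.prems(2)[of y] that sub by (auto simp: Y'_def intro: convex_on_subset)
    show "concave_on Y' (K x)" if "x \<in> convex hull F" for x
      using insert.prems(3)[of x] that sub cY'
      by (auto simp: Y'_def concave_on_def intro: convex_on_subset)
  qed auto
  then show ?case by (auto simp: Y'_def)
qed

text \<open>For a real \<beta> strictly below the inf-sup, the superlevel sets of all
  \<open>x\<close> have a common point: finitely many meet by the finite case, and all of them meet
  by the finite intersection property inside the one compact set at \<open>c\<close>. No topology on
  the minimizing side is involved.\<close>

lemma minimax_coercive:
  fixes K :: "'a::real_vector \<Rightarrow> 'b::{real_vector, t2_space} \<Rightarrow> real"
  assumes X: "convex X" and Y: "convex Y"
    and cvx: "\<And>y. y \<in> Y \<Longrightarrow> convex_on X (\<lambda>x. K x y)"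
    and ccv: "\<And>x. x \<in> X \<Longrightarrow> concave_on Y (K x)"
    and clo: "\<And>x \<beta>. x \<in> X \<Longrightarrow> closed {y \<in> Y. \<beta> \<le> K x y}"
    and c: "c \<in> X" and com: "\<And>\<beta>. compact {y \<in> Y. \<beta> \<le> K c y}"
  shows "(INF x\<in>X. SUP y\<in>Y. ereal (K x y)) = (SUP y\<in>Y. INF x\<in>X. ereal (K x y))"
proof (rule antisym)
  show "(SUP y\<in>Y. INF x\<in>X. ereal (K x y)) \<le> (INF x\<in>X. SUP y\<in>Y. ereal (K x y))"
    by (intro SUP_least INF_greatest) (meson INF_lower SUP_upper order_trans)
  show "(INF x\<in>X. SUP y\<in>Y. ereal (K x y)) \<le> (SUP y\<in>Y. INF x\<in>X. ereal (K x y))"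
  proof (rule dense_le)
    fix z assume z: "z < (INF x\<in>X. SUP y\<in>Y. ereal (K x y))"
    show "z \<le> (SUP y\<in>Y. INF x\<in>X. ereal (K x y))"
    proof (cases z)
      case (real \<beta>)
      have ex: "\<exists>y\<in>Y. K x y > \<beta>" if "x \<in> X" for x
        using less_INF_D[OF z that] by (auto simp: less_SUP_iff real)
      have "{y \<in> Y. \<beta> \<le> K c y} \<inter> (\<Inter>x\<in>X. {y \<in> Y. \<beta> \<le> K x y}) \<noteq> {}"
      proof (rule compact_imp_fip_image[OF com clo])
        fix F assume F: "finite F" "F \<subseteq> X"
        have sub: "convex hull (insert c F) \<subseteq> X"
          using F c X by (intro hull_minimal) auto
        \<comment> \<open>Adding \<open>c\<close> makes the finite set nonempty and places the
          common point in the compact superlevel set.\<close>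
        have "\<exists>y\<in>Y. \<forall>x\<in>insert c F. K x y > \<beta>"
        proof (rule minimax_finite)
          show "convex_on (convex hull insert c F) (\<lambda>x. K x y)" if "y \<in> Y" for y
            using cvx[OF that] sub by (rule convex_on_subset) auto
        qed (use F Y ccv ex sub in auto)
        then obtain y where "y \<in> Y" "\<And>x. x \<in> insert c F \<Longrightarrow> \<beta> \<le> K x y"
          by (meson less_imp_le)
        then have "y \<in> {y \<in> Y. \<beta> \<le> K c y} \<inter> (\<Inter>x\<in>F. {y \<in> Y. \<beta> \<le> K x y})"
          by auto
        then show "{y \<in> Y. \<beta> \<le> K c y} \<inter> (\<Inter>x\<in>F. {y \<in> Y. \<beta> \<le> K x y}) \<noteq> {}"
          by blast
      qed
      then obtain y where y: "y \<in> Y" "\<And>x. x \<in> X \<Longrightarrow> \<beta> \<le> K x y" by auto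
      then have "ereal \<beta> \<le> (INF x\<in>X. ereal (K x y))" by (auto intro: INF_greatest)
      with y(1) show ?thesis unfolding real by (rule SUP_upper2)
    \<comment> \<open>The value \<infinity> is excluded by the strict inequality \<open>z\<close>,
      and \<open>-\<infinity>\<close> is below everything.\<close>
    qed (use z in auto)
  qed
qed

section \<open>Growth of concave functions against a quadratic penalty\<close>

text \<open>Outside the unit ball, \<open>y\<close> is pulled back along its ray to the unit sphere.
  Concavity between \<open>0\<close> and \<open>y\<close> then bounds the growth by the size of the
  function on the compact unit ball.\<close>

lemma concave_on_linear_upper_bound:
  fixes \<phi> :: "'a::euclidean_space \<Rightarrow> real"
  assumes "concave_on UNIV \<phi>"
  obtains M where "\<And>y. \<phi> y \<le> M * norm y + M"
proof -
  have "continuous_on UNIV (\<lambda>y. - \<phi> y)"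
    using assms by (intro convex_on_continuous) (auto simp: concave_on_def)
  then have "continuous_on (cball 0 1) (\<lambda>y. - \<phi> y)" by (rule continuous_on_subset) auto
  then have "bounded ((\<lambda>y. - \<phi> y) ` cball 0 1)"
    by (intro compact_imp_bounded compact_continuous_image) auto
  then obtain B where B: "\<And>y. norm y \<le> 1 \<Longrightarrow> \<bar>\<phi> y\<bar> \<le> B"
    unfolding bounded_iff by (metis abs_minus_cancel imageI mem_cball_0 real_norm_def)
  have "B \<ge> 0" using B[of 0] by simp
  \<comment> \<open>One \<open>B\<close> bounds the value on the sphere, the other the value at the
    origin. Slope and intercept are taken equal so that a single constant serves both.\<close>
  have "\<phi> y \<le> 2 * B * norm y + 2 * B" for y
  proof (cases "norm y \<le> 1")
    case True
    then have "\<phi> y \<le> B" using B[of y] by simp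
    also have "B \<le> 2 * B * norm y + 2 * B" using \<open>B \<ge> 0\<close> by (simp add: add_increasing)
    finally show ?thesis .
  next
    case False
    define t where "t = 1 / norm y"
    have t: "0 \<le> t" "t \<le> 1" "t * norm y = 1"
      using False by (auto simp: t_def divide_le_eq)
    have "(1 - t) * \<phi> 0 + t * \<phi> y \<le> \<phi> ((1 - t) *\<^sub>R 0 + t *\<^sub>R y)"
      using assms t unfolding concave_on_iff by (auto simp del: scaleR_zero_right)
    moreover have "\<phi> (t *\<^sub>R y) \<le> B" using B[of "t *\<^sub>R y"] t by simp
    moreover have "- B \<le> (1 - t) * \<phi> 0"
    proof -
      have "\<bar>(1 - t) * \<phi> 0\<bar> \<le> 1 * B"
        unfolding abs_mult using B[of 0] t by (intro mult_mono) auto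
      then show ?thesis by simp
    qed
    ultimately have "t * \<phi> y \<le> 2 * B" by simp
    then have "norm y * (t * \<phi> y) \<le> norm y * (2 * B)" by (rule mult_left_mono) simp
    then have "\<phi> y \<le> 2 * B * norm y"
      using t(3) by (metis mult.assoc mult.commute mult.left_neutral)
    then show ?thesis using \<open>B \<ge> 0\<close> by simp
  qed
  then show ?thesis using that by metis
qed

lemma concave_minus_square_upper_bound:
  fixes \<phi> :: "'a::euclidean_space \<Rightarrow> real"
  assumes "concave_on UNIV \<phi>"
  obtains C where "\<And>y. \<phi> y - (norm (y - c))\<^sup>2 \<le> C - (norm y)\<^sup>2 / 2"
proof -
  obtain M where M: "\<And>y. \<phi> y \<le> M * norm y + M"
    using concave_on_linear_upper_bound[OF assms] by blast
  \<comment> \<open>The reverse triangle inequality leaves a quadratic in \<open>norm y\<close>.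
    Half of its square absorbs the linear term, and completing the square yields the
    constant.\<close>
  have "\<phi> y - (norm (y - c))\<^sup>2 \<le> (M + (M + 2 * norm c)\<^sup>2 / 2) - (norm y)\<^sup>2 / 2" for y
  proof -
    have "(norm y - norm c)\<^sup>2 \<le> (norm (y - c))\<^sup>2"
      using norm_triangle_ineq3[of y c] by (metis abs_le_square_iff abs_norm_cancel)
    moreover have "(M + 2 * norm c)\<^sup>2 / 2 + (norm y - norm c)\<^sup>2 - (M * norm y + (norm y)\<^sup>2 / 2)
        = (norm y - (M + 2 * norm c))\<^sup>2 / 2 + (norm c)\<^sup>2"
      by (simp add: power2_eq_square field_simps)
    moreover have "0 \<le> (norm y - (M + 2 * norm c))\<^sup>2 / 2 + (norm c)\<^sup>2" by simp
    ultimately show ?thesis using M[of y] by linarith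
  qed
  then show ?thesis using that by blast
qed

section \<open>Quadratic forms and the graph Laplacian\<close>

text \<open>The convexity gap between \<open>x\<close> and \<open>y\<close> is
  \<open>t * (1 - t)\<close> times the value of the form at \<open>x - y\<close>.\<close>

lemma convex_on_quadratic_form:
  fixes T :: "'a::real_inner \<Rightarrow> 'a"
  assumes "linear T" and psd: "\<And>x. 0 \<le> inner x (T x)"
  shows "convex_on UNIV (\<lambda>x. inner x (T x))"
proof (intro convex_onI)
  interpret linear T by fact
  fix t :: real and x y :: 'a assume t: "0 < t" "t < 1"
  have "(1 - t) * inner x (T x) + t * inner y (T y)
        - inner ((1 - t) *\<^sub>R x + t *\<^sub>R y) (T ((1 - t) *\<^sub>R x + t *\<^sub>R y))
      = t * (1 - t) * inner (x - y) (T (x - y))"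
    by (simp add: add diff scale inner_add_left inner_add_right inner_diff_left
        inner_diff_right algebra_simps)
  moreover have "0 \<le> t * (1 - t) * inner (x - y) (T (x - y))"
    using t psd by simp
  ultimately show "inner ((1 - t) *\<^sub>R x + t *\<^sub>R y) (T ((1 - t) *\<^sub>R x + t *\<^sub>R y))
      \<le> (1 - t) * inner x (T x) + t * inner y (T y)"
    by simp
qed auto

lemma laplacian_mult_component:
  "(laplacian A *v x) $ i = (\<Sum>j\<in>UNIV. A $ i $ j * (x $ i - x $ j))"
proof -
  have "(laplacian A *v x) $ i
      = (\<Sum>j\<in>UNIV. (if i = j then (\<Sum>l\<in>UNIV. A $ i $ l) * x $ j else 0) - A $ i $ j * x $ j)"
    unfolding matrix_vector_mult_def laplacian_def degree_matrix_def
    by (auto intro!: sum.cong simp: left_diff_distrib)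
  also have "\<dots> = (\<Sum>j\<in>UNIV. A $ i $ j * (x $ i - x $ j))"
    by (simp add: sum_subtractf right_diff_distrib sum_distrib_right)
  finally show ?thesis .
qed

text \<open>Symmetrising the double sum shows that the form is half the sum of
  \<open>A $ i $ j * (x $ i - x $ j)\<^sup>2\<close>, and the weights are nonnegative.\<close>

lemma laplacian_psd:
  assumes "weighted_graph E A"
  shows "0 \<le> x \<bullet> (laplacian A *v x)"
proof -
  have "transpose A = A" and nonneg: "A $ i $ j \<ge> 0" for i j
    using assms by (cases "(i, j) \<in> E"; auto simp: weighted_graph_def less_imp_le)+
  then have sym: "A $ i $ j = A $ j $ i" for i j
    using arg_cong[of "transpose A" A "\<lambda>B. B $ j $ i"] by (simp add: transpose_def vec_eq_iff)
  define S where "S = (\<Sum>i\<in>UNIV. \<Sum>j\<in>UNIV. A $ i $ j * x $ i * (x $ i - x $ j))"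
  have xS: "x \<bullet> (laplacian A *v x) = S"
    unfolding S_def inner_vec_def laplacian_mult_component
    by (simp add: sum_distrib_left mult.assoc mult.left_commute)
  have "S = (\<Sum>i\<in>UNIV. \<Sum>j\<in>UNIV. A $ i $ j * x $ j * (x $ j - x $ i))"
    unfolding S_def by (subst sum.swap, intro sum.cong refl) (metis sym)
  then have "S + S = (\<Sum>i\<in>UNIV. \<Sum>j\<in>UNIV. A $ i $ j * x $ i * (x $ i - x $ j)
      + A $ i $ j * x $ j * (x $ j - x $ i))"
    by (simp only: sum.distrib) (simp only: S_def)
  also have "\<dots> = (\<Sum>i\<in>UNIV. \<Sum>j\<in>UNIV. A $ i $ j * (x $ i - x $ j)\<^sup>2)"
    by (intro sum.cong refl) (simp add: power2_eq_square algebra_simps)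
  also have "\<dots> \<ge> 0" by (simp add: sum_nonneg nonneg)
  finally have "S \<ge> 0" by simp
  then show ?thesis by (simp add: xS)
qed

text \<open>The Kronecker product with the identity acts on each coordinate \<open>j\<close>
  separately, as \<open>M\<close> across the agents. Positive semidefiniteness of the Laplacian thus
  passes to the form on \<open>x\<close>.\<close>

lemma inner_kronecker_mat_1:
  fixes M :: "real^'n::finite^'n" and x :: "real^('n \<times> 'd::finite)"
  shows "x \<bullet> (kronecker M (mat 1 :: real^'d^'d) *v x)
       = (\<Sum>j\<in>UNIV. (\<chi> i. x $ (i, j)) \<bullet> (M *v (\<chi> i. x $ (i, j))))"
proof -
  have comp: "(kronecker M (mat 1 :: real^'d^'d) *v x) $ (i, j) = (M *v (\<chi> i. x $ (i, j))) $ i"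
    for i j
  proof -
    have "(kronecker M (mat 1 :: real^'d^'d) *v x) $ (i, j)
        = (\<Sum>c\<in>UNIV \<times> UNIV. M $ i $ fst c * (if j = snd c then 1 else 0) * x $ c)"
      by (simp add: matrix_vector_mult_def kronecker_def mat_def)
    also have "\<dots> = (\<Sum>l\<in>UNIV. \<Sum>q\<in>UNIV. if j = q then M $ i $ l * x $ (l, q) else 0)"
      unfolding sum.cartesian_product by (intro sum.cong) auto
    finally have "(kronecker M (mat 1 :: real^'d^'d) *v x) $ (i, j)
        = (\<Sum>l\<in>UNIV. \<Sum>q\<in>UNIV. if j = q then M $ i $ l * x $ (l, q) else 0)" .
    then show ?thesis by (simp add: matrix_vector_mult_def)
  qed
  have "x \<bullet> (kronecker M (mat 1 :: real^'d^'d) *v x)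
      = (\<Sum>i\<in>UNIV. \<Sum>j\<in>UNIV. x $ (i, j) * (M *v (\<chi> i. x $ (i, j))) $ i)"
    by (simp add: inner_vec_def sum.cartesian_product comp[symmetric] split_def
        del: UNIV_Times_UNIV flip: UNIV_Times_UNIV)
  also have "\<dots> = (\<Sum>j\<in>UNIV. (\<chi> i. x $ (i, j)) \<bullet> (M *v (\<chi> i. x $ (i, j))))"
    by (subst sum.swap) (simp add: inner_vec_def)
  finally show ?thesis .
qed

lemma convex_on_compose_linear:
  assumes "convex_on UNIV \<phi>" "linear T"
  shows "convex_on UNIV (\<lambda>x. \<phi> (T x))"
proof -
  interpret linear T by fact
  show ?thesis using assms(1) by (auto simp: convex_on_def add scale)
qed

lemma convex_on_linear:
  fixes T :: "'a::real_vector \<Rightarrow> real"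
  assumes "linear T"
  shows "convex_on UNIV T"
proof -
  interpret linear T by fact
  show ?thesis by (auto simp: convex_on_def add scale)
qed

lemma convex_on_sum_fun:
  assumes "finite I" "convex S" "\<And>i. i \<in> I \<Longrightarrow> convex_on S (\<phi> i)"
  shows "convex_on S (\<lambda>x. \<Sum>i\<in>I. \<phi> i x)"
  using assms by (induction I rule: finite_induct) (auto simp: convex_on_const intro!: convex_on_add)

section \<open>Convexity, concavity and coercivity of the augmented Lagrangian\<close>

text \<open>With the samples fixed, the penalty is linear in the multiplier, so the convexity is
  joint and holds on the whole space. The two Laplacian squares are convex by positive
  semidefiniteness.\<close>

lemma L_aug_convex:
  fixes f :: "real^'d::finite \<Rightarrow> real^'m::finite \<Rightarrow> real" and \<xi>hat :: "'k::finite \<Rightarrow> real^'m"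
  assumes graph: "weighted_graph E A"
    and f_convex: "\<And>\<xi>. convex_on UNIV (\<lambda>x. f x \<xi>)"
  shows "convex_on UNIV (\<lambda>z. L_aug \<epsilon> f \<xi>hat v A (fst z) (snd z) \<nu> \<eta> \<xi>s)"
proof -
  let ?L = "laplacian A"
  let ?K = "kronecker ?L (mat 1 :: real^'d^'d)"
  have f: "convex_on UNIV (\<lambda>z. f (block (fst z) (v k)) (\<xi>s k))" for k
    by (rule convex_on_compose_linear[OF f_convex])
      (auto intro!: linearI simp: block_def vec_eq_iff)
  have l: "convex_on UNIV (\<lambda>z. - (snd z $ v k * (norm (\<xi>s k - \<xi>hat k))\<^sup>2))" for k
    by (intro convex_on_linear linearI) (auto simp: algebra_simps)
  have g: "convex_on UNIV (\<lambda>z. g_fun f \<xi>hat k (block (fst z) (v k)) (snd z $ v k) (\<xi>s k))" for k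
    using convex_on_add[OF f[of k] l[of k]] by (simp add: g_fun_def)
  have h: "convex_on UNIV (\<lambda>z. h_fun \<epsilon> (snd z))"
    unfolding h_fun_def
    by (intro convex_on_linear linearI) (auto simp: inner_add_right add_divide_distrib algebra_simps)
  have lin: "convex_on UNIV (\<lambda>z. \<nu> \<bullet> (?L *v snd z))" "convex_on UNIV (\<lambda>z. \<eta> \<bullet> (?K *v fst z))"
    by (intro convex_on_linear linearI;
        simp add: matrix_vector_right_distrib inner_add_right matrix_vector_mult_scaleR)+
  have qx: "convex_on UNIV (\<lambda>x. x \<bullet> (?K *v x))"
    by (intro convex_on_quadratic_form matrix_vector_mul_linear)
      (simp add: inner_kronecker_mat_1 sum_nonneg laplacian_psd[OF graph])
  have ql: "convex_on UNIV (\<lambda>x. x \<bullet> (?L *v x))"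
    by (intro convex_on_quadratic_form matrix_vector_mul_linear laplacian_psd[OF graph])
  show ?thesis
    unfolding L_aug_def
    by (intro convex_on_add convex_on_cmul convex_on_sum_fun g h lin
        convex_on_compose_linear[OF qx] convex_on_compose_linear[OF ql] linear_fst linear_snd) auto
qed

text \<open>Here the sign of \<open>lv\<close> matters: each squared distance enters with
  coefficient \<open>- lv $ v k\<close>. The sample family is packed into one vector
  \<open>y\<close>, so that the maximizing side is a Euclidean space.\<close>

lemma L_aug_concave:
  fixes f :: "real^'d::finite \<Rightarrow> real^'m::finite \<Rightarrow> real" and \<xi>hat :: "'k::finite \<Rightarrow> real^'m"
  assumes f_concave: "\<And>x. concave_on UNIV (\<lambda>\<xi>. f x \<xi>)" and "0 \<le> lv"
  shows "concave_on UNIV (\<lambda>y. L_aug \<epsilon> f \<xi>hat v A xv lv \<nu> \<eta> (($) y))"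
proof -
  have sq: "convex_on UNIV (\<lambda>\<xi> :: real^'m. (norm (\<xi> - c))\<^sup>2)" for c
  proof -
    have "convex_on UNIV (\<lambda>\<xi> :: real^'m. - 2 * (c \<bullet> \<xi>))"
      by (intro convex_on_linear linearI) (auto simp: inner_add_right)
    then have "convex_on UNIV (\<lambda>\<xi> :: real^'m. \<xi> \<bullet> \<xi> + (- 2 * (c \<bullet> \<xi>)) + c \<bullet> c)"
      by (intro convex_on_add convex_on_const[THEN iffD2] convex_on_quadratic_form linear_ident) auto
    then show ?thesis
      by (simp add: power2_norm_eq_inner inner_diff_left inner_diff_right inner_commute algebra_simps)
  qed
  have g: "convex_on UNIV (\<lambda>y. - g_fun f \<xi>hat k x l (y $ k))" if "0 \<le> l" for k x l
  proof -
    have "convex_on UNIV (\<lambda>\<xi>. - f x \<xi> + l * (norm (\<xi> - \<xi>hat k))\<^sup>2)"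
      using f_concave that by (intro convex_on_add convex_on_cmul sq) (auto simp: concave_on_def)
    then have "convex_on UNIV (\<lambda>\<xi>. - g_fun f \<xi>hat k x l \<xi>)"
      by (simp add: g_fun_def)
    then show ?thesis
      by (rule convex_on_compose_linear) (auto intro!: linearI)
  qed
  have "convex_on UNIV (\<lambda>y. 1 / real CARD('k) *
      (\<Sum>k\<in>UNIV. - g_fun f \<xi>hat k (block xv (v k)) (lv $ v k) (y $ k)) + - C)" for C
    using \<open>0 \<le> lv\<close>
    by (intro convex_on_add convex_on_const[THEN iffD2] convex_on_cmul convex_on_sum_fun g)
      (auto simp: less_eq_vec_def)
  \<comment> \<open>The constant is the part of the Lagrangian independent of \<open>y\<close>,
    isolated by evaluating at \<open>\<xi>hat\<close> and removing the sample sum.\<close>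
  from this[of "L_aug \<epsilon> f \<xi>hat v A xv lv \<nu> \<eta> \<xi>hat - 1 / real CARD('k) *
      (\<Sum>k\<in>UNIV. g_fun f \<xi>hat k (block xv (v k)) (lv $ v k) (\<xi>hat k))"]
  show ?thesis
    unfolding concave_on_def L_aug_def by (simp add: sum_negf algebra_simps)
qed

text \<open>At the all-ones multiplier every sample is penalised with weight one. The bounds
  \<open>- (norm \<xi>)\<^sup>2 / 2\<close> for the single samples add up to
  \<open>- (norm y)\<^sup>2 / 2\<close>, so a lower bound on the Lagrangian limits
  \<open>norm y\<close>.\<close>

lemma L_aug_bounded_superlevel:
  fixes f :: "real^'d::finite \<Rightarrow> real^'m::finite \<Rightarrow> real" and \<xi>hat :: "'k::finite \<Rightarrow> real^'m"
  assumes f_concave: "\<And>x. concave_on UNIV (\<lambda>\<xi>. f x \<xi>)"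
  shows "bounded {y. \<beta> \<le> L_aug \<epsilon> f \<xi>hat v A xv 1 \<nu> \<eta> (($) y)}"
proof -
  have "\<exists>C. \<forall>\<xi>. g_fun f \<xi>hat k (block xv (v k)) 1 \<xi> \<le> C - (norm \<xi>)\<^sup>2 / 2" for k
    using concave_minus_square_upper_bound[OF f_concave, of _ "\<xi>hat k"]
    unfolding g_fun_def by (metis mult_1)
  then obtain C where C: "\<And>k \<xi>. g_fun f \<xi>hat k (block xv (v k)) 1 \<xi> \<le> C k - (norm \<xi>)\<^sup>2 / 2"
    by metis
  define B where "B = L_aug \<epsilon> f \<xi>hat v A xv 1 \<nu> \<eta> \<xi>hat - 1 / real CARD('k) *
      (\<Sum>k\<in>UNIV. g_fun f \<xi>hat k (block xv (v k)) 1 (\<xi>hat k))"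
  have L: "L_aug \<epsilon> f \<xi>hat v A xv 1 \<nu> \<eta> (($) y) = B + 1 / real CARD('k) *
      (\<Sum>k\<in>UNIV. g_fun f \<xi>hat k (block xv (v k)) 1 (y $ k))" for y
    by (simp add: B_def L_aug_def)
  have "(norm y)\<^sup>2 \<le> 2 * (sum C UNIV - real CARD('k) * (\<beta> - B))"
    if "\<beta> \<le> L_aug \<epsilon> f \<xi>hat v A xv 1 \<nu> \<eta> (($) y)" for y
  proof -
    have "real CARD('k) * (\<beta> - B) \<le> (\<Sum>k\<in>UNIV. g_fun f \<xi>hat k (block xv (v k)) 1 (y $ k))"
      using that unfolding L by (simp add: field_simps)
    also have "\<dots> \<le> (\<Sum>k\<in>UNIV. C k - (norm (y $ k))\<^sup>2 / 2)"
      by (intro sum_mono C)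
    also have "\<dots> = sum C UNIV - (norm y)\<^sup>2 / 2"
      by (simp add: sum_subtractf norm_vec_def L2_set_def sum_nonneg sum_divide_distrib)
    finally show ?thesis by simp
  qed
  then show ?thesis
    by (intro boundedI) (auto intro: real_le_rsqrt)
qed

theorem mainTheorem6:
  fixes E :: "('n::finite \<times> 'n) set" and A :: "real^'n^'n"
    and \<epsilon> :: real
    and f :: "real^'d::finite \<Rightarrow> real^'m::finite \<Rightarrow> real"
    and \<xi>hat :: "'k::finite \<Rightarrow> real^'m" and v :: "'k \<Rightarrow> 'n"
    and \<nu> :: "real^'n" and \<eta> :: "real^('n \<times> 'd)"
  assumes eps: "\<epsilon> \<ge> 0"
    and graph: "weighted_graph E A" and conn: "graph_connected E"
    and holders: "surj v"
    and C1: "continuously_differentiable (\<lambda>(x, \<xi>). f x \<xi>)"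
    and recession: "closure {\<xi>. \<not> recession_direction (\<lambda>x. f x \<xi>) 1 \<and>
                               \<not> recession_direction (\<lambda>x. f x \<xi>) (- 1)} = UNIV"
    and P_domain: "interior {(l, x). l \<ge> 0 \<and> \<bar>P_objective \<epsilon> f \<xi>hat l x\<bar> \<noteq> \<infinity>} \<noteq> {}"
    and P_optimizer: "\<exists>ls xs. \<bar>P_objective \<epsilon> f \<xi>hat ls xs\<bar> \<noteq> \<infinity> \<and>
          is_arg_min (\<lambda>(l, x). P_objective \<epsilon> f \<xi>hat l x) (\<lambda>(l, x). l \<ge> 0) (ls, xs)"
    and f_convex: "\<And>\<xi>. convex_on UNIV (\<lambda>x. f x \<xi>)"
    and f_concave: "\<And>x. concave_on UNIV (\<lambda>\<xi>. f x \<xi>)"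
  shows "(INF (xv, lv) \<in> UNIV \<times> {lv. 0 \<le> lv}. SUP \<xi>s. ereal (L_aug \<epsilon> f \<xi>hat v A xv lv \<nu> \<eta> \<xi>s))
       = (SUP \<xi>s. INF (xv, lv) \<in> UNIV \<times> {lv. 0 \<le> lv}. ereal (L_aug \<epsilon> f \<xi>hat v A xv lv \<nu> \<eta> \<xi>s))"
proof -
  define X :: "((real^('n \<times> 'd)) \<times> (real^'n)) set" where "X = UNIV \<times> {lv. 0 \<le> lv}"
  \<comment> \<open>Sample families become vectors, for which compactness and continuity of concave
    functions are available; \<open>reindex\<close> carries the suprema back to functions.\<close>
  define K where
    "K = (\<lambda>z (y :: real^'m^'k). L_aug \<epsilon> f \<xi>hat v A (fst z) (snd z) \<nu> \<eta> (($) y))"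
  have "convex {lv :: real^'n. 0 \<le> lv}"
    by (auto simp: convex_def less_eq_vec_def)
  then have X: "convex X"
    unfolding X_def by (intro convex_Times) auto
  have ccv: "concave_on UNIV (K z)" if "z \<in> X" for z
    using that L_aug_concave[of f, OF f_concave] by (auto simp: K_def X_def)
  have clo: "closed {y \<in> UNIV. \<beta> \<le> K z y}" if "z \<in> X" for z \<beta>
  proof -
    have "continuous_on UNIV (\<lambda>y. - K z y)"
      using ccv[OF that] by (intro convex_on_continuous) (auto simp: concave_on_def)
    then have "continuous_on UNIV (K z)"
      using continuous_on_minus by fastforce
    then show ?thesis by (auto intro: closed_Collect_le)
  qed
  have x0: "(0, 1) \<in> X" by (simp add: X_def less_eq_vec_def)
  have com: "compact {y \<in> UNIV. \<beta> \<le> K (0, 1) y}" for \<beta>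
    using clo[OF x0] L_aug_bounded_superlevel[of f, OF f_concave]
    by (simp add: compact_eq_bounded_closed K_def)
  have minimax: "(INF z\<in>X. SUP y\<in>UNIV. ereal (K z y)) = (SUP y\<in>UNIV. INF z\<in>X. ereal (K z y))"
  proof (rule minimax_coercive[where c = "(0, 1)"])
    show "convex_on X (\<lambda>z. K z y)" for y
      unfolding K_def
      by (rule convex_on_subset[OF L_aug_convex[where f = f, OF graph f_convex]]) (auto simp: X)
  qed (use X ccv clo x0 com in auto)
  have "range (($) :: real^'m^'k \<Rightarrow> _) = UNIV"
    by (metis surj_def vec_lambda_inverse UNIV_I)
  then have reindex: "(SUP \<xi>s. G \<xi>s) = (SUP y :: real^'m^'k. G (($) y))"
    for G :: "('k \<Rightarrow> real^'m) \<Rightarrow> ereal"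
    by (metis image_image)
  show ?thesis
    using minimax unfolding reindex by (simp add: K_def X_def split_def)
qed

end
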